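(* Let $\Gamma$ be a set of labelled formulas and $\alpha:\phi$ a labelled formula. If $\Gamma\vdash\alpha:\phi$ (derivability in the labelled natural deduction system for LTP), then $\Gamma\vDash\alpha:\phi$.
   Context: **Semantics.** Boolean algebras $B$ are written with operations $0,1,-,+,\cdot$ (bottom, top, complement, join, meet); the one-element Boolean algebra is allowed. The powerset $\mathcal{P}(B)$ carries external operations $\bot=\emptyset$, $\neg X=B\setminus X$, $X\vee Y=X\cup Y$, $X\wedge Y=X\cap Y$, and internal operations $\dot\bot=\{0\}$, $\dot\neg X=\{-a\mid a\in X\}$, $X\mathbin{\dot\vee}Y=\{a+b\mid a\in X,b\in Y\}$, $X\mathbin{\dot\wedge}Y=\{a\cdot b\mid a\in X,b\in Y\}$. The formulas of LTP form the absolutely free algebra $\mathrm{Fm}$ generated by propositional variables $P_0,P_1,\dots$ using constants $\bot,\dot\bot$, unary $\neg,\dot\neg$, and binary $\vee,\wedge,\dot\vee,\dot\wedge$. Put $\dot\top:=\dot\neg\dot\bot$. Homomorphisms $H:\mathrm{Fm}\to\mathcal{P}(B)$ preserve all eight operations. **Labels.** Labels form the absolutely free algebra $\mathrm{Lb}$ generated by atomic labels $p_0,p_1,\dots$ using $0$, unary $-$, binary $+,\cdot$ (i.e. they are classical propositional formulas, with $0$ falsum, $-$ negation, $+$ disjunction, $\cdot$ conjunction). Homomorphisms $h:\mathrm{Lb}\to B$ preserve $0,-,+,\cdot$. A labelled formula is a pair $\alpha:\phi$ with $\alpha\in\mathrm{Lb}$, $\phi\in\mathrm{Fm}$. $\alpha\leftrightarrow\beta$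 abbreviates $(\alpha+-\beta)\cdot(-\alpha+\beta)$, and $\alpha=\beta$ abbreviates the labelled formula $(\alpha\leftrightarrow\beta):\dot\top$. **Entailment.** $\Gamma\vDash\beta:\psi$ iff for all Boolean algebras $B$ and homomorphisms $h:\mathrm{Lb}\to B$, $H:\mathrm{Fm}\to\mathcal{P}(B)$: if $h(\alpha)\in H(\phi)$ for all $\alpha:\phi\in\Gamma$, then $h(\beta)\in H(\psi)$. **Deduction system.** $\Gamma\vdash\alpha:\phi$ means there is a natural deduction tree with conclusion $\alpha:\phi$ whose undischarged assumptions all lie in $\Gamma$, using the following rules ($\alpha,\beta,\alpha_i$ arbitrary labels, $\phi,\psi,\sigma$ arbitrary formulas; vacuous discharge allowed): - taut: from $\alpha_1:\dot\top,\dots,\alpha_k:\dot\top$ ($k\ge 0$) infer $\beta:\dot\top$, provided $\alpha_1,\dots,\alpha_k\vdash\beta$ in classical propositional logic. - sub: from $\alpha=\beta$ and $\alpha:\phi$ infer $\beta:\phi$. - $\wedge$I: from $\alpha:\phi$ and $\alpha:\psi$ infer $\alpha:\phi\wedge\psi$. $\wedge$E: from $\alpha:\phi\wedge\psi$ infer $\alpha:\phi$; likewise infer $\alpha:\psi$. - $\vee$I: from $\alpha:\phi$ infer $\alpha:\phi\vee\psi$; from $\alpha:\psi$ infer $\alpha:\phi\vee\psi$. $\vee$E: from $\alpha:\phi\vee\psi$, a derivation of $\beta:\sigma$ from $[\alpha:\phi]$, and a derivation of $\beta:\sigma$ from $[\alpha:\psi]$, infer $\beta:\sigma$ (bracketed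 assumptions discharged). - $\neg$I: from a derivation of $\beta:\bot$ from $[\alpha:\phi]$ infer $\alpha:\neg\phi$. $\neg$E: from $\alpha:\phi$ and $\alpha:\neg\phi$ infer $\beta:\bot$. - RAA: from a derivation of $\beta:\bot$ from $[\alpha:\neg\phi]$ infer $\alpha:\phi$. $\bot$E: from $\alpha:\bot$ infer $\beta:\phi$. - $\dot\wedge$I: from $\alpha:\phi$ and $\beta:\psi$ infer $\alpha\cdot\beta:\phi\mathbin{\dot\wedge}\psi$. $\dot\wedge$E: from $\alpha:\phi\mathbin{\dot\wedge}\psi$ and a derivation of $\beta:\sigma$ from $[p:\phi],[q:\psi],[\alpha=p\cdot q]$ infer $\beta:\sigma$. - $\dot\vee$I: from $\alpha:\phi$ and $\beta:\psi$ infer $\alpha+\beta:\phi\mathbin{\dot\vee}\psi$. $\dot\vee$E: from $\alpha:\phi\mathbin{\dot\vee}\psi$ and a derivation of $\beta:\sigma$ from $[p:\phi],[q:\psi],[\alpha=p+q]$ infer $\beta:\sigma$. - $\dot\neg$I: from $\alpha:\phi$ infer $-\alpha:\dot\neg\phi$. $\dot\neg$E: from $\alpha:\dot\neg\phi$ infer $-\alpha:\phi$. In $\dot\wedge$E and $\dot\vee$E, $p$ and $q$ are distinct atomic labels that do not occur in any uncancelled assumption (other than the bracketed ones discharged by the rule), nor in $\alpha$ or $\beta$. *)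

theory Defs
  imports Main
begin

datatype lb =
    Atom nat
  | LZero
  | LNeg lb
  | LSum lb lb
  | LProd lb lb

primrec atoms :: "lb \<Rightarrow> nat set" where
  "atoms (Atom p) = {p}"
| "atoms LZero = {}"
| "atoms (LNeg \<alpha>) = atoms \<alpha>"
| "atoms (LSum \<alpha> \<beta>) = atoms \<alpha> \<union> atoms \<beta>"
| "atoms (LProd \<alpha> \<beta>) = atoms \<alpha> \<union> atoms \<beta>"

text \<open>The prefix \<open>D\<close> marks the dotted (internal) connectives.\<close>

datatype fm =
    PVar nat
  | Bot
  | DBot
  | Neg fm
  | DNeg fm
  | Or fm fm
  | And fm fm
  | DOr fm fm
  | DAnd fm fm

abbreviation DTop :: fm where
  "DTop \<equiv> DNeg DBot"

type_synonym lfm = "lb \<times> fm"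

abbreviation LIff :: "lb \<Rightarrow> lb \<Rightarrow> lb" where
  "LIff \<alpha> \<beta> \<equiv> LProd (LSum \<alpha> (LNeg \<beta>)) (LSum (LNeg \<alpha>) \<beta>)"

abbreviation LEq :: "lb \<Rightarrow> lb \<Rightarrow> lfm" where
  "LEq \<alpha> \<beta> \<equiv> (LIff \<alpha> \<beta>, DTop)"

text \<open>
  A Boolean algebra is a type of class \<open>boolean_algebra\<close>; the class does not require
  \<open>bot \<noteq> top\<close>, so the one-element algebra is included.  The external operations on the
  powerset are those of the set type.
\<close>

definition dneg :: "'b::boolean_algebra set \<Rightarrow> 'b set" where
  "dneg X = {- a |a. a \<in> X}"

definition dor :: "'b::boolean_algebra set \<Rightarrow> 'b set \<Rightarrow> 'b set" where
  "dor X Y = {sup a b |a b. a \<in> X \<and> b \<in> Y}"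

definition dand :: "'b::boolean_algebra set \<Rightarrow> 'b set \<Rightarrow> 'b set" where
  "dand X Y = {inf a b |a b. a \<in> X \<and> b \<in> Y}"

definition lb_hom :: "(lb \<Rightarrow> 'b::boolean_algebra) \<Rightarrow> bool" where
  "lb_hom h \<longleftrightarrow>
     h LZero = bot \<and>
     (\<forall>\<alpha>. h (LNeg \<alpha>) = - h \<alpha>) \<and>
     (\<forall>\<alpha> \<beta>. h (LSum \<alpha> \<beta>) = sup (h \<alpha>) (h \<beta>)) \<and>
     (\<forall>\<alpha> \<beta>. h (LProd \<alpha> \<beta>) = inf (h \<alpha>) (h \<beta>))"

definition fm_hom :: "(fm \<Rightarrow> 'b::boolean_algebra set) \<Rightarrow> bool" where
  "fm_hom H \<longleftrightarrow>
     H Bot = {} \<and>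
     H DBot = {bot} \<and>
     (\<forall>\<phi>. H (Neg \<phi>) = UNIV - H \<phi>) \<and>
     (\<forall>\<phi>. H (DNeg \<phi>) = dneg (H \<phi>)) \<and>
     (\<forall>\<phi> \<psi>. H (Or \<phi> \<psi>) = H \<phi> \<union> H \<psi>) \<and>
     (\<forall>\<phi> \<psi>. H (And \<phi> \<psi>) = H \<phi> \<inter> H \<psi>) \<and>
     (\<forall>\<phi> \<psi>. H (DOr \<phi> \<psi>) = dor (H \<phi>) (H \<psi>)) \<and>
     (\<forall>\<phi> \<psi>. H (DAnd \<phi> \<psi>) = dand (H \<phi>) (H \<psi>))"

text \<open>
  Types cannot be quantified inside a formula, so entailment takes the Boolean algebra as a
  type argument.  Entailment over all Boolean algebras is this predicate with \<open>'b\<close> a free type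
  variable.
\<close>

definition entails :: "'b::boolean_algebra itself \<Rightarrow> lfm set \<Rightarrow> lfm \<Rightarrow> bool" where
  "entails (_ :: 'b itself) \<Gamma> c \<longleftrightarrow>
     (\<forall>(h :: lb \<Rightarrow> 'b) (H :: fm \<Rightarrow> 'b set). lb_hom h \<longrightarrow> fm_hom H \<longrightarrow>
        (\<forall>(\<alpha>, \<phi>)\<in>\<Gamma>. h \<alpha> \<in> H \<phi>) \<longrightarrow> h (fst c) \<in> H (snd c))"

text \<open>Classical propositional consequence between labels, by Gentzen natural deduction.\<close>

inductive cpl :: "lb set \<Rightarrow> lb \<Rightarrow> bool" where
  cpl_assm: "\<alpha> \<in> \<Delta> \<Longrightarrow> cpl \<Delta> \<alpha>"
| cpl_prodI: "cpl \<Delta> \<alpha> \<Longrightarrow> cpl \<Delta> \<beta> \<Longrightarrow> cpl \<Delta> (LProd \<alpha> \<beta>)"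
| cpl_prodE1: "cpl \<Delta> (LProd \<alpha> \<beta>) \<Longrightarrow> cpl \<Delta> \<alpha>"
| cpl_prodE2: "cpl \<Delta> (LProd \<alpha> \<beta>) \<Longrightarrow> cpl \<Delta> \<beta>"
| cpl_sumI1: "cpl \<Delta> \<alpha> \<Longrightarrow> cpl \<Delta> (LSum \<alpha> \<beta>)"
| cpl_sumI2: "cpl \<Delta> \<beta> \<Longrightarrow> cpl \<Delta> (LSum \<alpha> \<beta>)"
| cpl_sumE: "cpl \<Delta> (LSum \<alpha> \<beta>) \<Longrightarrow> cpl (insert \<alpha> \<Delta>) \<gamma> \<Longrightarrow> cpl (insert \<beta> \<Delta>) \<gamma> \<Longrightarrow> cpl \<Delta> \<gamma>"
| cpl_negI: "cpl (insert \<alpha> \<Delta>) LZero \<Longrightarrow> cpl \<Delta> (LNeg \<alpha>)"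
| cpl_negE: "cpl \<Delta> \<alpha> \<Longrightarrow> cpl \<Delta> (LNeg \<alpha>) \<Longrightarrow> cpl \<Delta> LZero"
| cpl_raa: "cpl (insert (LNeg \<alpha>) \<Delta>) LZero \<Longrightarrow> cpl \<Delta> \<alpha>"

text \<open>
  \<open>ded A c\<close>: there is a natural deduction tree with conclusion \<open>c\<close> whose set of undischarged
  assumptions is exactly \<open>A\<close>.  Tracking the exact set matters for the eigenvariable conditions,
  which concern the undischarged assumptions of the tree and not an ambient set \<open>\<Gamma>\<close>.

  In a rule discharging an assumption \<open>x\<close>, the set \<open>D \<subseteq> {x}\<close> is \<open>{x}\<close> if all occurrences of \<open>x\<close>
  are discharged and \<open>{}\<close> if some are left open; discharge is vacuous if \<open>x\<close> is not among the
  assumptions of the subtree.  In \<open>DAndE\<close> and \<open>DOrE\<close> every bracketed assumption contains an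
  eigenvariable, so none of them may be left open.
\<close>

definition fresh :: "nat \<Rightarrow> lfm set \<Rightarrow> bool" where
  "fresh p A \<longleftrightarrow> (\<forall>(\<alpha>, \<phi>)\<in>A. p \<notin> atoms \<alpha>)"

inductive ded :: "lfm set \<Rightarrow> lfm \<Rightarrow> bool" where
  Assm: "ded {(\<alpha>, \<phi>)} (\<alpha>, \<phi>)"
| Taut: "(\<And>i. i < length \<alpha>s \<Longrightarrow> ded (A i) (\<alpha>s ! i, DTop)) \<Longrightarrow> cpl (set \<alpha>s) \<beta> \<Longrightarrow>
    ded (\<Union>i<length \<alpha>s. A i) (\<beta>, DTop)"
| Sub: "ded A (LEq \<alpha> \<beta>) \<Longrightarrow> ded B (\<alpha>, \<phi>) \<Longrightarrow> ded (A \<union> B) (\<beta>, \<phi>)"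
| AndI: "ded A (\<alpha>, \<phi>) \<Longrightarrow> ded B (\<alpha>, \<psi>) \<Longrightarrow> ded (A \<union> B) (\<alpha>, And \<phi> \<psi>)"
| AndE1: "ded A (\<alpha>, And \<phi> \<psi>) \<Longrightarrow> ded A (\<alpha>, \<phi>)"
| AndE2: "ded A (\<alpha>, And \<phi> \<psi>) \<Longrightarrow> ded A (\<alpha>, \<psi>)"
| OrI1: "ded A (\<alpha>, \<phi>) \<Longrightarrow> ded A (\<alpha>, Or \<phi> \<psi>)"
| OrI2: "ded A (\<alpha>, \<psi>) \<Longrightarrow> ded A (\<alpha>, Or \<phi> \<psi>)"
| OrE: "ded A (\<alpha>, Or \<phi> \<psi>) \<Longrightarrow> ded B (\<beta>, \<sigma>) \<Longrightarrow> ded C (\<beta>, \<sigma>) \<Longrightarrow>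
    D \<subseteq> {(\<alpha>, \<phi>)} \<Longrightarrow> E \<subseteq> {(\<alpha>, \<psi>)} \<Longrightarrow>
    ded (A \<union> (B - D) \<union> (C - E)) (\<beta>, \<sigma>)"
| NegI: "ded A (\<beta>, Bot) \<Longrightarrow> D \<subseteq> {(\<alpha>, \<phi>)} \<Longrightarrow> ded (A - D) (\<alpha>, Neg \<phi>)"
| NegE: "ded A (\<alpha>, \<phi>) \<Longrightarrow> ded B (\<alpha>, Neg \<phi>) \<Longrightarrow> ded (A \<union> B) (\<beta>, Bot)"
| RAA: "ded A (\<beta>, Bot) \<Longrightarrow> D \<subseteq> {(\<alpha>, Neg \<phi>)} \<Longrightarrow> ded (A - D) (\<alpha>, \<phi>)"
| BotE: "ded A (\<alpha>, Bot) \<Longrightarrow> ded A (\<beta>, \<phi>)"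
| DAndI: "ded A (\<alpha>, \<phi>) \<Longrightarrow> ded B (\<beta>, \<psi>) \<Longrightarrow> ded (A \<union> B) (LProd \<alpha> \<beta>, DAnd \<phi> \<psi>)"
| DAndE: "ded A (\<alpha>, DAnd \<phi> \<psi>) \<Longrightarrow> ded B (\<beta>, \<sigma>) \<Longrightarrow>
    B' = B - {(Atom p, \<phi>), (Atom q, \<psi>), LEq \<alpha> (LProd (Atom p) (Atom q))} \<Longrightarrow>
    p \<noteq> q \<Longrightarrow> fresh p B' \<Longrightarrow> fresh q B' \<Longrightarrow>
    p \<notin> atoms \<alpha> \<union> atoms \<beta> \<Longrightarrow> q \<notin> atoms \<alpha> \<union> atoms \<beta> \<Longrightarrow>
    ded (A \<union> B') (\<beta>, \<sigma>)"
| DOrI: "ded A (\<alpha>, \<phi>) \<Longrightarrow> ded B (\<beta>, \<psi>) \<Longrightarrow> ded (A \<union> B) (LSum \<alpha> \<beta>, DOr \<phi> \<psi>)"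
| DOrE: "ded A (\<alpha>, DOr \<phi> \<psi>) \<Longrightarrow> ded B (\<beta>, \<sigma>) \<Longrightarrow>
    B' = B - {(Atom p, \<phi>), (Atom q, \<psi>), LEq \<alpha> (LSum (Atom p) (Atom q))} \<Longrightarrow>
    p \<noteq> q \<Longrightarrow> fresh p B' \<Longrightarrow> fresh q B' \<Longrightarrow>
    p \<notin> atoms \<alpha> \<union> atoms \<beta> \<Longrightarrow> q \<notin> atoms \<alpha> \<union> atoms \<beta> \<Longrightarrow>
    ded (A \<union> B') (\<beta>, \<sigma>)"
| DNegI: "ded A (\<alpha>, \<phi>) \<Longrightarrow> ded A (LNeg \<alpha>, DNeg \<phi>)"
| DNegE: "ded A (\<alpha>, DNeg \<phi>) \<Longrightarrow> ded A (LNeg \<alpha>, \<phi>)"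

definition derivable :: "lfm set \<Rightarrow> lfm \<Rightarrow> bool" where
  "derivable \<Gamma> c \<longleftrightarrow> (\<exists>A\<subseteq>\<Gamma>. ded A c)"

end

theory Submission
  imports Defs
begin

text \<open>
  Soundness by induction on the derivation, for all valuations of the atomic labels at once:
  in the elimination rules of \<open>DAnd\<close> and \<open>DOr\<close> the valuation is changed at the eigenvariables
  to the two components of the given element.
\<close>

primrec val :: "(nat \<Rightarrow> 'b::boolean_algebra) \<Rightarrow> lb \<Rightarrow> 'b" where
  "val v (Atom p) = v p"
| "val v LZero = bot"
| "val v (LNeg \<alpha>) = - val v \<alpha>"
| "val v (LSum \<alpha> \<beta>) = sup (val v \<alpha>) (val v \<beta>)"
| "val v (LProd \<alpha> \<beta>) = inf (val v \<alpha>) (val v \<beta>)"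

text \<open>Labels are freely generated by the atoms, so a homomorphism is determined by its values
  there. Valuations are the convenient form: unlike homomorphisms, they can be changed freely at a
  single atom.\<close>

lemma lb_hom_eq_val:
  assumes "lb_hom h"
  shows "h = val (h \<circ> Atom)"
proof
  show "h \<alpha> = val (h \<circ> Atom) \<alpha>" for \<alpha>
    using assms by (induction \<alpha>) (simp_all add: lb_hom_def)
qed

lemma val_upd [simp]: "p \<notin> atoms \<alpha> \<Longrightarrow> val (v(p := a)) \<alpha> = val v \<alpha>"
  by (induction \<alpha>) simp_all

text \<open>Each factor of the meet expresses one of the two inequalities: by shunting,
  \<open>sup a (- b) = top\<close> amounts to \<open>b \<le> a\<close>.\<close>

lemma val_LIff_eq_top_iff: "val v (LIff \<alpha> \<beta>) = top \<longleftrightarrow> val v \<alpha> = val v \<beta>"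
proof
  assume "val v (LIff \<alpha> \<beta>) = top"
  then have "sup (val v \<alpha>) (- val v \<beta>) = top" "sup (- val v \<alpha>) (val v \<beta>) = top"
    by (simp_all add: inf_eq_top_iff)
  then have "val v \<beta> \<le> val v \<alpha>" "val v \<alpha> \<le> val v \<beta>"
    by (simp_all only: sup_shunt sup.commute[of "val v \<alpha>"] double_compl)
  then show "val v \<alpha> = val v \<beta>"
    by (rule antisym[rotated])
qed simp

text \<open>
  The lower bound \<open>c\<close> stands for the context: discharging \<open>\<alpha>\<close> replaces \<open>c\<close> by its meet with
  the value of \<open>\<alpha>\<close>.  With \<open>c = top\<close> alone the induction fails.
\<close>

lemma cpl_lower_bound:
  assumes "cpl \<Delta> \<beta>" and "\<And>\<alpha>. \<alpha> \<in> \<Delta> \<Longrightarrow> c \<le> val v \<alpha>"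
  shows "c \<le> val v \<beta>"
  using assms
proof (induction arbitrary: c)
  case (cpl_sumE \<Delta> \<alpha> \<beta> \<gamma>)
  have "inf c (val v \<alpha>) \<le> val v \<gamma>"
    by (rule cpl_sumE.IH(2)) (auto intro: le_infI1 cpl_sumE.prems)
  moreover have "inf c (val v \<beta>) \<le> val v \<gamma>"
    by (rule cpl_sumE.IH(3)) (auto intro: le_infI1 cpl_sumE.prems)
  moreover have "c \<le> sup (val v \<alpha>) (val v \<beta>)"
    using cpl_sumE.IH(1)[OF cpl_sumE.prems] by simp
  \<comment> \<open>By distributivity, \<open>c\<close> is the join of its meets with the two
    disjuncts, and both meets lie below the value of \<open>\<gamma>\<close>.\<close>
  ultimately show ?case
    by (metis inf.absorb1 inf_sup_distrib1 sup_least)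
next
  case (cpl_negI \<alpha> \<Delta>)
  have "inf c (val v \<alpha>) \<le> val v LZero"
    by (rule cpl_negI.IH) (auto intro: le_infI1 cpl_negI.prems)
  \<comment> \<open>Shunting: a meet with \<open>c\<close> is \<open>bot\<close> exactly when
    \<open>c\<close> lies below the complement of the other factor.\<close>
  then show ?case
    by (simp add: inf_shunt bot_unique)
next
  case (cpl_negE \<Delta> \<alpha>)
  then have "c \<le> inf (val v \<alpha>) (- val v \<alpha>)"
    unfolding le_inf_iff val.simps by blast
  then show ?case
    by simp
next
  case (cpl_raa \<alpha> \<Delta>)
  have "inf c (- val v \<alpha>) \<le> val v LZero"
    by (rule cpl_raa.IH) (auto intro: le_infI1 cpl_raa.prems)
  then show ?case
    by (simp add: inf_shunt bot_unique)
qed (auto intro: le_supI1 le_supI2)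

definition sat :: "(nat \<Rightarrow> 'b::boolean_algebra) \<Rightarrow> (fm \<Rightarrow> 'b set) \<Rightarrow> lfm set \<Rightarrow> bool" where
  "sat v H A \<longleftrightarrow> (\<forall>(\<alpha>, \<phi>)\<in>A. val v \<alpha> \<in> H \<phi>)"

lemma sat_Un [simp]: "sat v H (A \<union> B) \<longleftrightarrow> sat v H A \<and> sat v H B"
  by (auto simp: sat_def)

lemma sat_upd [simp]: "fresh p A \<Longrightarrow> sat (v(p := a)) H A = sat v H A"
  unfolding sat_def fresh_def by (rule ball_cong) auto

lemma sat_Diff:
  assumes "sat v H (A - D)" and "sat v H D"
  shows "sat v H A"
  using assms by (auto simp: sat_def)

text \<open>\<open>D\<close> may be empty or the singleton, so full, partial and vacuous discharge
  are handled together.\<close>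

lemma sat_discharge:
  assumes "sat v H (A - D)" and "D \<subseteq> {(\<alpha>, \<phi>)}" and "val v \<alpha> \<in> H \<phi>"
  shows "sat v H A"
  using assms by (auto simp: sat_def)

context
  fixes H :: "fm \<Rightarrow> 'b::boolean_algebra set"
  assumes H: "fm_hom H"
begin

lemma fm_hom_simps [simp]:
  "H Bot = {}" "H DBot = {bot}" "H (Neg \<phi>) = UNIV - H \<phi>" "H (DNeg \<phi>) = dneg (H \<phi>)"
  "H (Or \<phi> \<psi>) = H \<phi> \<union> H \<psi>" "H (And \<phi> \<psi>) = H \<phi> \<inter> H \<psi>"
  "H (DOr \<phi> \<psi>) = dor (H \<phi>) (H \<psi>)" "H (DAnd \<phi> \<psi>) = dand (H \<phi>) (H \<psi>)"
  using H by (simp_all add: fm_hom_def)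

lemma fm_hom_DTop: "H DTop = {top}"
  by (simp add: dneg_def)

lemma val_LEq_mem_iff: "val v (LIff \<alpha> \<beta>) \<in> H DTop \<longleftrightarrow> val v \<alpha> = val v \<beta>"
  unfolding fm_hom_DTop singleton_iff by (rule val_LIff_eq_top_iff)

text \<open>The common core of \<open>DAndE\<close> and \<open>DOrE\<close>, where
  \<open>\<gamma>\<close> is the product or the sum of the eigenvariables. Giving these the values
  \<open>a\<close> and \<open>b\<close> makes the bracketed assumptions true, while freshness leaves
  \<open>B'\<close> and the values of \<open>\<alpha>\<close> and \<open>\<beta>\<close>
  undisturbed. Thus \<open>sound\<close> is applied at a valuation other than
  \<open>v\<close>.\<close>

lemma eigenvariables_sound:
  assumes sound: "\<And>v. sat v H B \<Longrightarrow> val v \<beta> \<in> H \<sigma>"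
    and pq: "p \<noteq> q" "p \<notin> atoms \<alpha> \<union> atoms \<beta>" "q \<notin> atoms \<alpha> \<union> atoms \<beta>"
    and B': "B' = B - {(Atom p, \<phi>), (Atom q, \<psi>), LEq \<alpha> \<gamma>}"
      "fresh p B'" "fresh q B'" "sat v H B'"
    and ab: "a \<in> H \<phi>" "b \<in> H \<psi>" "val v \<alpha> = val (v(p := a, q := b)) \<gamma>"
  shows "val v \<beta> \<in> H \<sigma>"
proof -
  let ?w = "v(p := a, q := b)"
  have "val ?w (LIff \<alpha> \<gamma>) \<in> H DTop"
    unfolding val_LEq_mem_iff using pq ab by simp
  \<comment> \<open>The update at \<open>q\<close> does not overwrite the value \<open>a\<close> at
    \<open>p\<close>, since \<open>p \<noteq> q\<close>.\<close>
  then have "sat ?w H {(Atom p, \<phi>), (Atom q, \<psi>), LEq \<alpha> \<gamma>}"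
    using pq ab by (simp add: sat_def del: val.simps(2-) fm_hom_simps)
  moreover have "sat ?w H B'"
    using B' by simp
  ultimately have "sat ?w H B"
    unfolding B'(1) by (rule sat_Diff[rotated])
  then have "val ?w \<beta> \<in> H \<sigma>"
    by (rule sound)
  then show ?thesis
    using pq by simp
qed

text \<open>\<open>H\<close> can stay fixed while \<open>v\<close> varies in the induction: formulas
  contain no labels, so reassigning eigenvariables affects only \<open>v\<close>.\<close>

lemma ded_sound:
  assumes "ded A c" and "sat v H A"
  shows "val v (fst c) \<in> H (snd c)"
  using assms
proof (induction arbitrary: v)
  case (Assm \<alpha> \<phi>)
  then show ?case
    by (simp add: sat_def)
next
  case (Taut \<alpha>s A \<beta>)
  have "val v (\<alpha>s ! i) = top" if "i < length \<alpha>s" for i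
  proof -
    have "sat v H (A i)"
      using Taut.prems that by (auto simp: sat_def)
    then have "val v (\<alpha>s ! i) \<in> H DTop"
      using Taut.IH[OF that] by simp
    then show ?thesis
      unfolding fm_hom_DTop by simp
  qed
  \<comment> \<open>All premises take the value \<open>top\<close>, so \<open>top\<close> itself
    serves as the lower bound.\<close>
  then have "top \<le> val v \<beta>"
    by (intro cpl_lower_bound[OF Taut.hyps(2)]) (auto simp: in_set_conv_nth)
  then show ?case
    by (simp add: fm_hom_DTop top_unique del: fm_hom_simps)
next
  case (Sub A \<alpha> \<beta> B \<phi>)
  then have "val v (LIff \<alpha> \<beta>) \<in> H DTop" "val v \<alpha> \<in> H \<phi>"
    by (simp_all del: val.simps fm_hom_simps)
  then show ?case
    unfolding val_LEq_mem_iff by simp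
next
  case (OrE A \<alpha> \<phi> \<psi> B \<beta> \<sigma> C D E)
  then consider "val v \<alpha> \<in> H \<phi>" | "val v \<alpha> \<in> H \<psi>"
    by auto
  then show ?case
  proof cases
    case 1
    then have "sat v H B"
      using OrE.prems OrE.hyps(4) sat_discharge[of v H B D] by simp
    then show ?thesis
      by (rule OrE.IH(2))
  next
    case 2
    then have "sat v H C"
      using OrE.prems OrE.hyps(5) sat_discharge[of v H C E] by simp
    then show ?thesis
      by (rule OrE.IH(3))
  qed
next
  case (NegI A \<beta> D \<alpha> \<phi>)
  \<comment> \<open>Otherwise \<open>A\<close> would be satisfied, and the value of
    \<open>\<beta>\<close> would lie in the empty set \<open>H Bot\<close>.\<close>
  have "val v \<alpha> \<notin> H \<phi>"
    using sat_discharge[OF NegI.prems NegI.hyps(2)] NegI.IH by auto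
  then show ?case
    by simp
next
  case (NegE A \<alpha> \<phi> B \<beta>)
  \<comment> \<open>No valuation satisfies the assumptions of both premises, so the case is
    vacuous.\<close>
  have "val v \<alpha> \<in> H \<phi>" "val v \<alpha> \<notin> H \<phi>"
    using NegE.IH[of v] NegE.prems by simp_all
  then show ?case
    by contradiction
next
  case (RAA A \<beta> D \<alpha> \<phi>)
  have "val v \<alpha> \<notin> H (Neg \<phi>)"
    using sat_discharge[OF RAA.prems RAA.hyps(2)] RAA.IH by auto
  then show ?case
    by simp
next
  case (BotE A \<alpha> \<beta> \<phi>)
  then show ?case
    by fastforce
next
  case (DAndE A \<alpha> \<phi> \<psi> B \<beta> \<sigma> B' p q)
  have "val v \<alpha> \<in> dand (H \<phi>) (H \<psi>)"
    using DAndE.IH(1)[of v] DAndE.prems by simp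
  then obtain a b where ab: "a \<in> H \<phi>" "b \<in> H \<psi>" and \<alpha>: "val v \<alpha> = inf a b"
    by (auto simp: dand_def)
  have "val v \<alpha> = val (v(p := a, q := b)) (LProd (Atom p) (Atom q))"
    using \<alpha> \<open>p \<noteq> q\<close> by simp
  moreover have "sat v H B'"
    using DAndE.prems by simp
  moreover have "\<And>v. sat v H B \<Longrightarrow> val v \<beta> \<in> H \<sigma>"
    using DAndE.IH(2) by simp
  ultimately have "val v \<beta> \<in> H \<sigma>"
    using eigenvariables_sound[OF _ DAndE.hyps(4,7,8,3,5,6) _ ab] by blast
  then show ?case
    by simp
next
  case (DOrE A \<alpha> \<phi> \<psi> B \<beta> \<sigma> B' p q)
  have "val v \<alpha> \<in> dor (H \<phi>) (H \<psi>)"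
    using DOrE.IH(1)[of v] DOrE.prems by simp
  then obtain a b where ab: "a \<in> H \<phi>" "b \<in> H \<psi>" and \<alpha>: "val v \<alpha> = sup a b"
    by (auto simp: dor_def)
  have "val v \<alpha> = val (v(p := a, q := b)) (LSum (Atom p) (Atom q))"
    using \<alpha> \<open>p \<noteq> q\<close> by simp
  moreover have "sat v H B'"
    using DOrE.prems by simp
  moreover have "\<And>v. sat v H B \<Longrightarrow> val v \<beta> \<in> H \<sigma>"
    using DOrE.IH(2) by simp
  ultimately have "val v \<beta> \<in> H \<sigma>"
    using eigenvariables_sound[OF _ DOrE.hyps(4,7,8,3,5,6) _ ab] by blast
  then show ?case
    by simp
next
  case (DNegE A \<alpha> \<phi>)
  then have "val v \<alpha> \<in> dneg (H \<phi>)"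
    by simp
  \<comment> \<open>The value of \<open>\<alpha>\<close> is the complement of an element of
    \<open>H \<phi>\<close>; complementing again returns that element.\<close>
  then show ?case
    by (auto simp: dneg_def)
\<comment> \<open>In the remaining rules the external connectives are plain set operations, and the
  dotted introductions take the values of their premises as witnesses.\<close>
qed (simp_all, (force simp: dneg_def dor_def dand_def)+)

end

theorem theorem2p14:
  fixes \<Gamma> :: "lfm set" and \<alpha> :: lb and \<phi> :: fm
  assumes "derivable \<Gamma> (\<alpha>, \<phi>)"
  shows "entails TYPE('b::boolean_algebra) \<Gamma> (\<alpha>, \<phi>)"
  unfolding entails_def
proof (intro allI impI)
  fix h :: "lb \<Rightarrow> 'b" and H :: "fm \<Rightarrow> 'b set"
  assume h: "lb_hom h" and H: "fm_hom H" and \<Gamma>: "\<forall>(\<alpha>, \<phi>)\<in>\<Gamma>. h \<alpha> \<in> H \<phi>"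
  obtain A where A: "A \<subseteq> \<Gamma>" "ded A (\<alpha>, \<phi>)"
    using assms by (auto simp: derivable_def)
  \<comment> \<open>\<open>h\<close> is the valuation it induces on atoms, and satisfaction passes
    from \<open>\<Gamma>\<close> to the open assumptions \<open>A\<close> of the tree.\<close>
  have "sat (h \<circ> Atom) H A"
    unfolding sat_def lb_hom_eq_val[OF h, symmetric] using A(1) \<Gamma> by blast
  then have "val (h \<circ> Atom) (fst (\<alpha>, \<phi>)) \<in> H (snd (\<alpha>, \<phi>))"
    by (rule ded_sound[OF H A(2)])
  then show "h (fst (\<alpha>, \<phi>)) \<in> H (snd (\<alpha>, \<phi>))"
    unfolding lb_hom_eq_val[OF h, symmetric] .
qed

end
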